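(* Let $V$ be a smooth finite-dimensional real Banach space with the induced semi-inner product $[\cdot,\cdot]$, and let $A:V\to V$ be a linear operator which is adjoint abelian with respect to $[\cdot,\cdot]$. Then $V$ can be decomposed into a direct sum of $A$-invariant subspaces of dimension at most two such that the restriction of $A$ to each $2$-dimensional component is a generalized dilatation. That is, each $2$-dimensional component has a basis $\{a_s,b_s\}$ satisfying $$[a_s,a_s]=[b_s,b_s]=1,\qquad [a_s,b_s]=[b_s,a_s]=0,$$ with respect to which the restriction of $A$ has the matrix $$ \left[A|_{\operatorname{lin}\{a_s,b_s\}}\right]_{\{a_s,b_s\}}=|\lambda|\begin{pmatrix} \cos\varphi & \sin\varphi \\ -\sin\varphi & \cos\varphi \end{pmatrix} $$ for some $|\lambda|\in\mathbb{R}^+$ and some $0<\varphi\leq 2\pi$ (depending on the component).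
   Context: A semi-inner product (s.i.p.) on a real vector space $V$ is a function $[\cdot,\cdot]:V\times V\to\mathbb{R}$ such that for all $x,y,z\in V$ and $\lambda\in\mathbb{R}$: $[x+y,z]=[x,z]+[y,z]$; $[\lambda x,y]=\lambda[x,y]$; $[x,x]>0$ if $x\neq 0$; $|[x,y]|^2\leq [x,x][y,y]$. It induces the norm $\|x\|=\sqrt{[x,x]}$. A normed space is smooth if its norm is Gâteaux differentiable at every nonzero point (equivalently, its unit ball has a unique supporting hyperplane at each boundary point). On a smooth normed space there is exactly one s.i.p. with $[x,x]=\|x\|^2$ for all $x$, and this is the induced s.i.p. A linear operator $A:V\to V$ is adjoint abelian with respect to $[\cdot,\cdot]$ if $[A(x),y]=[x,A(y)]$ for all $x,y\in V$. $\operatorname{lin}$ denotes linear span. In the matrix of an operator with respect to an ordered basis, the columns are the coordinate vectors of the images of the basis vectors. *)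

theory Defs
  imports "HOL-Analysis.Analysis"
begin

definition semi_inner_product :: "('a::real_vector \<Rightarrow> 'a \<Rightarrow> real) \<Rightarrow> bool" where
  "semi_inner_product ip \<longleftrightarrow>
     (\<forall>x y z. ip (x + y) z = ip x z + ip y z) \<and>
     (\<forall>c x y. ip (c *\<^sub>R x) y = c * ip x y) \<and>
     (\<forall>x. x \<noteq> 0 \<longrightarrow> ip x x > 0) \<and>
     (\<forall>x y. \<bar>ip x y\<bar>\<^sup>2 \<le> ip x x * ip y y)"

(* On a smooth space there is exactly one ip with this property, so the predicate
   pins down the induced semi-inner product of the norm. *)
definition induced_semi_inner_product :: "('a::real_normed_vector \<Rightarrow> 'a \<Rightarrow> real) \<Rightarrow> bool" where
  "induced_semi_inner_product ip \<longleftrightarrow>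
     semi_inner_product ip \<and> (\<forall>x. ip x x = (norm x)\<^sup>2)"

definition gateaux_differentiable_at ::
    "('a::real_normed_vector \<Rightarrow> real) \<Rightarrow> 'a \<Rightarrow> bool" where
  "gateaux_differentiable_at f x \<longleftrightarrow>
     (\<exists>D. bounded_linear D \<and>
        (\<forall>h. ((\<lambda>t. (f (x + t *\<^sub>R h) - f x) / t) \<longlongrightarrow> D h) (at 0)))"

definition smooth_norm :: "'a::real_normed_vector itself \<Rightarrow> bool" where
  "smooth_norm _ \<longleftrightarrow> (\<forall>x::'a. x \<noteq> 0 \<longrightarrow> gateaux_differentiable_at norm x)"

definition adjoint_abelian ::
    "('a::real_vector \<Rightarrow> 'a \<Rightarrow> real) \<Rightarrow> ('a \<Rightarrow> 'a) \<Rightarrow> bool" where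
  "adjoint_abelian ip A \<longleftrightarrow> linear A \<and> (\<forall>x y. ip (A x) y = ip x (A y))"

definition direct_sum_decomposition :: "nat \<Rightarrow> (nat \<Rightarrow> 'a::real_vector set) \<Rightarrow> bool" where
  "direct_sum_decomposition n W \<longleftrightarrow>
     (\<forall>i<n. subspace (W i)) \<and>
     (\<forall>v. \<exists>!w. w \<in> (\<Pi>\<^sub>E i\<in>{..<n}. W i) \<and> v = (\<Sum>i<n. w i))"

definition invariant_subspace :: "('a::real_vector \<Rightarrow> 'a) \<Rightarrow> 'a set \<Rightarrow> bool" where
  "invariant_subspace A W \<longleftrightarrow> subspace W \<and> A ` W \<subseteq> W"

(* M is the matrix, with respect to the ordered basis (a, b), of the restriction of A to
   span {a, b}: columns are the coordinates of the images, and M $ i $ j is the entry in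
   row i and column j. *)
definition has_matrix_on_basis2 ::
    "('a::real_vector \<Rightarrow> 'a) \<Rightarrow> 'a \<Rightarrow> 'a \<Rightarrow> real^2^2 \<Rightarrow> bool" where
  "has_matrix_on_basis2 A a b M \<longleftrightarrow>
     A a = (M $ 1 $ 1) *\<^sub>R a + (M $ 2 $ 1) *\<^sub>R b \<and>
     A b = (M $ 1 $ 2) *\<^sub>R a + (M $ 2 $ 2) *\<^sub>R b"

definition generalized_dilatation_on ::
    "('a::real_vector \<Rightarrow> 'a \<Rightarrow> real) \<Rightarrow> ('a \<Rightarrow> 'a) \<Rightarrow> 'a set \<Rightarrow> bool" where
  "generalized_dilatation_on ip A W \<longleftrightarrow>
     (\<exists>a b r \<phi>.
        a \<noteq> b \<and> independent {a, b} \<and> span {a, b} = W \<and>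
        ip a a = 1 \<and> ip b b = 1 \<and> ip a b = 0 \<and> ip b a = 0 \<and>
        0 < r \<and> 0 < \<phi> \<and> \<phi> \<le> 2 * pi \<and>
        has_matrix_on_basis2 A a b
          (r *\<^sub>R vector [vector [cos \<phi>, sin \<phi>], vector [- sin \<phi>, cos \<phi>]]))"

end

theory Submission
  imports Defs
begin

text \<open>
  The operator \<open>A\<close> turns out to be diagonalizable over the reals, so the decomposition can be made
  of lines spanned by eigenvectors and no plane ever occurs in it.

  Smoothness enters through the equality case of the Cauchy-Schwarz inequality
  (\<open>Cauchy_Schwarz_equality\<close>): if \<open>\<bar>[x, y]\<bar> = \<parallel>x\<parallel> \<parallel>y\<parallel>\<close> with \<open>x\<close> and \<open>y\<close> nonzero, then the
  functionals \<open>[\<cdot>, x]\<close> and \<open>[\<cdot>, y]\<close> are proportional, because up to a factor both support the ball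
  at \<open>x\<close> (\<open>x\<close> and \<open>y\<close> themselves may well be independent, as the norm need not be strictly
  convex). In particular \<open>[\<cdot>, \<cdot>]\<close> is homogeneous in its second argument.

  Now let \<open>W \<noteq> 0\<close> be an \<open>A\<close>-invariant subspace and let \<open>x \<in> W\<close> maximize the ratio
  \<open>\<parallel>A x\<parallel> / \<parallel>x\<parallel>\<close>, with maximum \<open>r\<close>. Then
  \<open>r\<^sup>2 \<parallel>x\<parallel>\<^sup>2 = [A x, A x] = [x, A\<^sup>2 x] \<le> \<parallel>x\<parallel> \<parallel>A\<^sup>2 x\<parallel> \<le> r\<^sup>2 \<parallel>x\<parallel>\<^sup>2\<close>, so equality holds throughout
  and \<open>[h, A\<^sup>2 x] = r\<^sup>2 [h, x]\<close> for all \<open>h\<close>, that is, \<open>[(A\<^sup>2 - r\<^sup>2) h, x] = 0\<close>. Since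
  \<open>[x, x] \<noteq> 0\<close>, the operator \<open>A\<^sup>2 - r\<^sup>2 = (A + r) (A - r)\<close> does not map \<open>W\<close> onto itself, hence it
  is not injective on \<open>W\<close>, and one of \<open>r\<close>, \<open>-r\<close> is an eigenvalue of \<open>A\<close> on \<open>W\<close>
  (\<open>real_eigenvector_exists\<close>).

  If \<open>c\<close> is a real eigenvalue and \<open>S = A - c\<close>, then \<open>[S w, y] = [w, A y] - c [w, y]\<close>
  vanishes whenever \<open>S y = 0\<close>, because then \<open>[w, A y] = [w, c y] = c [w, y]\<close>. So \<open>ker S\<close> meets \<open>S W\<close> only in \<open>0\<close>, which gives
  \<open>W = (W \<inter> ker S) + S W\<close>; induction on the dimension shows that eigenvectors span the whole
  space (\<open>invariant_subspace_subset_span_eigenvectors\<close>). A basis chosen among them yields the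
  decomposition.
\<close>

section \<open>Finite-dimensional subspaces\<close>

lemma dim_strict_mono_subspace:
  fixes U W :: "'a::real_vector set"
  assumes "finite B" "span B = (UNIV :: 'a set)" "subspace U" "subspace W" "U \<subset> W"
  shows "dim U < dim W"
proof -
  obtain C where C: "C \<subseteq> B" "independent C" "B \<subseteq> span C"
    using maximal_independent_subset by blast
  have "span C = (UNIV :: 'a set)"
    using C(3) assms(2) span_minimal[of B "span C"] by auto
  then interpret finite_dimensional_vector_space "scaleR :: real \<Rightarrow> 'a \<Rightarrow> 'a" C
    using C assms(1) finite_subset by unfold_locales (auto simp: dependent_raw_def span_raw_def)
  show ?thesis
    using dim_psubset[of U W] assms(3-5) by (metis dim_raw_def span_raw_def span_eq_iff)
qed

lemma injective_endomorphism_onto: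
  fixes T :: "'a::real_vector \<Rightarrow> 'a"
  assumes "finite B" "span B = (UNIV :: 'a set)" "subspace W" "linear T"
    and "T ` W \<subseteq> W" and ker: "\<And>x. x \<in> W \<Longrightarrow> T x = 0 \<Longrightarrow> x = 0"
  shows "T ` W = W"
proof (rule ccontr)
  assume "T ` W \<noteq> W"
  with assms have lt: "dim (T ` W) < dim W"
    by (intro dim_strict_mono_subspace[of B]) (auto intro: linear_subspace_image)
  obtain C where C: "C \<subseteq> W" "independent C" "W \<subseteq> span C" "card C = dim W"
    using basis_exists by blast
  have sp: "span C = W"
    using C(1,3) assms(3) by (simp add: span_minimal subset_antisym)
  have inj: "inj_on T W"
    using linear_injective_on_subspace_0[OF assms(4,3)] ker by blast
  have "independent (T ` C)"
    using linear_independent_injective_image[OF assms(4) C(2)] inj sp by simp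
  moreover have "span (T ` C) = T ` W"
    using linear_span_image[OF assms(4)] sp by simp
  ultimately have "dim (T ` W) = card (T ` C)"
    using dim_span_eq_card_independent by metis
  also have "\<dots> = dim W"
    using card_image[OF inj_on_subset[OF inj C(1)]] C(4) by simp
  finally show False using lt by simp
qed

text \<open>The Heine-Borel property of finite-dimensional subspaces of an arbitrary normed space. In the
  induction step the span of the smaller set is closed by the induction hypothesis, so a new vector
  \<open>b\<close> has positive distance \<open>d\<close> from it; this forces \<open>\<bar>c\<bar> \<le> \<parallel>c b + s\<parallel> / d\<close> and confines the
  coefficient and the rest of a bounded vector to compact sets.\<close>

lemma compact_span_Int_cball:
  fixes B :: "'a::real_normed_vector set"
  assumes "finite B"
  shows "compact (span B \<inter> cball 0 R)"
  using assms
proof (induction B arbitrary: R rule: finite_induct)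
  case empty
  then show ?case by (auto simp: compact_Int_closed)
next
  case (insert b B)
  have closed: "closed (span B)"
    unfolding closed_sequential_limits
  proof safe
    fix f l assume f: "\<forall>n::nat. f n \<in> span B" "f \<longlonglongrightarrow> l"
    obtain K where "\<And>n. norm (f n) \<le> K"
      using convergent_imp_Bseq[OF convergentI[OF f(2)]] by (auto simp: Bseq_def)
    then have "\<forall>n. f n \<in> span B \<inter> cball 0 K" using f by auto
    then show "l \<in> span B"
      using compact_imp_closed[OF insert.IH[of K]] f(2)
      unfolding closed_sequential_limits by blast
  qed
  show ?case
  proof (cases "b \<in> span B")
    case True
    then show ?thesis using insert.IH by (simp add: span_redundant)
  next
    case False
    define d where "d = infdist b (span B)"
    have "span B \<noteq> {}" using span_zero by blast
    then have d: "d > 0"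
      using in_closed_iff_infdist_zero[OF closed] False infdist_nonneg[of b "span B"]
      unfolding d_def by fastforce
    define L where "L = (\<lambda>c. c *\<^sub>R b) ` {- (R/d)..R/d}"
    define M where "M = span B \<inter> cball 0 (R + R/d * norm b)"
    have "compact L" unfolding L_def
      by (intro compact_continuous_image continuous_intros) auto
    then have cpt: "compact {x + y |x y. x \<in> L \<and> y \<in> M}"
      unfolding M_def by (intro compact_sums insert.IH)
    have "span (insert b B) \<inter> cball 0 R = {x + y |x y. x \<in> L \<and> y \<in> M} \<inter> cball 0 R"
    proof (intro subset_antisym subsetI)
      fix x assume x: "x \<in> span (insert b B) \<inter> cball 0 R"
      then obtain c where c: "x - c *\<^sub>R b \<in> span B" by (auto simp: span_breakdown_eq)
      have xR: "norm x \<le> R" using x by simp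
      have R: "0 \<le> R" using xR norm_ge_zero[of x] by linarith
      have "\<bar>c\<bar> * d \<le> norm x"
      proof (cases "c = 0")
        case False
        \<comment> \<open>the point of the span that differs from \<open>b\<close> by \<open>x / c\<close>\<close>
        have "(-1/c) *\<^sub>R (x - c *\<^sub>R b) \<in> span B" using c by (rule span_scale)
        then have "d \<le> dist b ((-1/c) *\<^sub>R (x - c *\<^sub>R b))"
          unfolding d_def by (rule infdist_le)
        also have "\<dots> = norm ((1/c) *\<^sub>R x)"
          using False by (simp add: dist_norm algebra_simps)
        finally show ?thesis using False by (simp add: field_simps)
      qed simp
      then have cR: "\<bar>c\<bar> \<le> R/d" using d xR by (simp add: field_simps)
      have "norm (x - c *\<^sub>R b) \<le> norm x + \<bar>c\<bar> * norm b"
        using norm_triangle_ineq4[of x "c *\<^sub>R b"] by simp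
      also have "\<dots> \<le> R + R/d * norm b"
        using xR cR by (intro add_mono mult_right_mono) auto
      finally have "x - c *\<^sub>R b \<in> M" using c by (simp add: M_def)
      moreover have "c *\<^sub>R b \<in> L" using cR unfolding L_def by (intro imageI) auto
      moreover have "x = c *\<^sub>R b + (x - c *\<^sub>R b)" by simp
      ultimately show "x \<in> {x + y |x y. x \<in> L \<and> y \<in> M} \<inter> cball 0 R" using x by blast
    next
      fix x assume "x \<in> {x + y |x y. x \<in> L \<and> y \<in> M} \<inter> cball 0 R"
      then obtain c y where x: "x = c *\<^sub>R b + y" "y \<in> span B" "x \<in> cball 0 R"
        unfolding L_def M_def by auto
      then show "x \<in> span (insert b B) \<inter> cball 0 R"
        by (auto simp: span_breakdown_eq intro!: exI[of _ c])
    qed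
    then show ?thesis using compact_Int_closed[OF cpt closed_cball] by (simp only:)
  qed
qed

text \<open>The maximum is taken over the unit sphere of the graph of \<open>A\<close> over \<open>W\<close> instead of the unit
  sphere of \<open>W\<close>. The graph is itself finite-dimensional, so its unit sphere is compact, and
  \<open>\<parallel>A x\<parallel>\<close> becomes a projection followed by the norm, which is visibly continuous, whereas
  continuity of \<open>A\<close> on a finite-dimensional space is itself a consequence of compactness. On that
  sphere \<open>\<parallel>x\<parallel>\<^sup>2 + \<parallel>A x\<parallel>\<^sup>2 = 1\<close>, so a maximizer of \<open>\<parallel>A x\<parallel>\<close> also maximizes
  \<open>\<parallel>A x\<parallel> / \<parallel>x\<parallel>\<close>.\<close>

lemma operator_norm_attained:
  fixes A :: "'a::real_normed_vector \<Rightarrow> 'a" and W :: "'a set"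
  assumes fin: "finite B" "span B = (UNIV :: 'a set)"
    and W: "subspace W" "W \<noteq> {0}" and lin: "linear A"
  obtains x r where "x \<in> W" "x \<noteq> 0" "norm (A x) = r * norm x"
    "\<And>y. y \<in> W \<Longrightarrow> norm (A y) \<le> r * norm y"
proof -
  obtain C where C: "C \<subseteq> W" "independent C" "W \<subseteq> span C"
    using maximal_independent_subset by blast
  have sp: "span C = W" using C(1,3) W(1) by (simp add: span_minimal subset_antisym)
  have "finite C" using independent_span_bound[OF fin(1) C(2)] fin(2) by simp
  define g where "g = (\<lambda>x. (x, A x))"
  have "linear g" unfolding g_def using lin
    by (auto intro!: linearI simp: linear_add linear_scale)
  then have gW: "g ` W = span (g ` C)" using linear_span_image sp by metis
  define S where "S = g ` W \<inter> {p. norm p = 1}"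
  have "S = (g ` W \<inter> cball 0 1) \<inter> {p. norm p = 1}" unfolding S_def by auto
  moreover have "compact (g ` W \<inter> cball 0 1)"
    using compact_span_Int_cball[of "g ` C" 1] \<open>finite C\<close> gW by simp
  moreover have "closed {p :: 'a \<times> 'a. norm p = 1}"
    by (intro closed_Collect_eq continuous_intros)
  ultimately have "compact S" by (simp only: compact_Int_closed)
  have normalize: "g ((1 / norm (g y)) *\<^sub>R y) \<in> S" if "y \<in> W" "y \<noteq> 0" for y
  proof -
    have "norm (g y) \<noteq> 0" using that(2) by (simp add: g_def zero_prod_def)
    moreover have "g ((1 / norm (g y)) *\<^sub>R y) = (1 / norm (g y)) *\<^sub>R g y"
      using \<open>linear g\<close> by (rule linear_scale)
    moreover have "g ((1 / norm (g y)) *\<^sub>R y) \<in> g ` W"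
      using that W(1) by (intro imageI subspace_scale)
    ultimately show ?thesis unfolding S_def by simp
  qed
  obtain y0 where "y0 \<in> W" "y0 \<noteq> 0" using W subspace_0 by blast
  then have "S \<noteq> {}" using normalize by blast
  moreover have "continuous_on S (\<lambda>q. norm (snd q))" by (intro continuous_intros)
  ultimately obtain p where p: "p \<in> S" "\<And>q. q \<in> S \<Longrightarrow> norm (snd q) \<le> norm (snd p)"
    using continuous_attains_sup[OF \<open>compact S\<close>] by blast
  then obtain x where x: "x \<in> W" "p = g x" "norm (g x) = 1" unfolding S_def by auto
  have nx: "(norm x)\<^sup>2 + (norm (A x))\<^sup>2 = 1"
    using x(3) by (simp add: g_def norm_Pair)
  have "x \<noteq> 0" using nx linear_0[OF lin] by auto
  have bound: "(norm (A y))\<^sup>2 \<le> (norm (A x))\<^sup>2 * ((norm y)\<^sup>2 + (norm (A y))\<^sup>2)" if "y \<in> W" for y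
  proof (cases "y = 0")
    case False
    have n0: "norm (g y) > 0" using False by (simp add: g_def zero_prod_def)
    have "norm (A ((1 / norm (g y)) *\<^sub>R y)) \<le> norm (A x)"
      using p(2)[OF normalize[OF that False]] x(2) by (simp add: g_def)
    then have "norm (A y) \<le> norm (A x) * norm (g y)"
      using n0 lin by (simp add: linear_scale field_simps)
    then have "(norm (A y))\<^sup>2 \<le> (norm (A x) * norm (g y))\<^sup>2" by (rule power_mono) simp
    then show ?thesis by (simp add: power_mult_distrib g_def norm_Pair)
  qed (use linear_0[OF lin] in simp)
  define r where "r = norm (A x) / norm x"
  have "norm (A y) \<le> r * norm y" if "y \<in> W" for y
  proof -
    \<comment> \<open>the common term \<open>\<parallel>A x\<parallel>\<^sup>2 \<parallel>A y\<parallel>\<^sup>2\<close> cancels\<close>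
    have "(norm (A y))\<^sup>2 * ((norm x)\<^sup>2 + (norm (A x))\<^sup>2)
        \<le> (norm (A x))\<^sup>2 * ((norm y)\<^sup>2 + (norm (A y))\<^sup>2)"
      using bound[OF that] nx by simp
    then have "(norm (A y) * norm x)\<^sup>2 \<le> (norm (A x) * norm y)\<^sup>2"
      by (simp add: power_mult_distrib algebra_simps)
    then have "norm (A y) * norm x \<le> norm (A x) * norm y"
      by (rule power2_le_imp_le) simp
    then show ?thesis unfolding r_def using \<open>x \<noteq> 0\<close> by (simp add: field_simps)
  qed
  then show ?thesis using that[of x r] x(1) \<open>x \<noteq> 0\<close> by (simp add: r_def)
qed

section \<open>The induced semi-inner product of a smooth norm\<close>

text \<open>Since \<open>f\<close> stays below the norm and touches it at \<open>x\<close>, the difference quotient in direction \<open>h\<close>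
  is at least \<open>f h\<close> for positive \<open>t\<close> and at most \<open>f h\<close> for negative \<open>t\<close>.\<close>

lemma supporting_functional_eq_derivative:
  fixes f :: "'a::real_normed_vector \<Rightarrow> real"
  assumes lim: "((\<lambda>t. (norm (x + t *\<^sub>R h) - norm x) / t) \<longlongrightarrow> d) (at 0)"
    and lin: "linear f" and le: "\<And>h. f h \<le> norm h" and x: "f x = norm x"
  shows "f h = d"
proof (rule antisym)
  have ineq: "t * f h \<le> norm (x + t *\<^sub>R h) - norm x" for t
    using le[of "x + t *\<^sub>R h"] x lin by (simp add: linear_add linear_scale)
  have "((\<lambda>t. (norm (x + t *\<^sub>R h) - norm x) / t) \<longlongrightarrow> d) (at_right 0)"
    using lim by (rule filterlim_mono) (auto simp: at_le)
  moreover have "\<forall>\<^sub>F t in at_right 0. f h \<le> (norm (x + t *\<^sub>R h) - norm x) / t"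
    using eventually_at_right_less[of "0::real"]
    by eventually_elim (use ineq in \<open>simp add: field_simps\<close>)
  ultimately show "f h \<le> d"
    using tendsto_lowerbound[OF _ _ trivial_limit_at_right_real] by blast
  have "((\<lambda>t. (norm (x + t *\<^sub>R h) - norm x) / t) \<longlongrightarrow> d) (at_left 0)"
    using lim by (rule filterlim_mono) (auto simp: at_le)
  moreover have "\<forall>\<^sub>F t in at_left 0. (norm (x + t *\<^sub>R h) - norm x) / t \<le> f h"
    using eventually_at_left_real[of "-1" "0::real", simplified]
    by eventually_elim (use ineq in \<open>simp add: field_simps\<close>)
  ultimately show "d \<le> f h"
    using tendsto_upperbound[OF _ _ trivial_limit_at_left_real] by blast
qed

lemma supporting_functional_unique:
  fixes f g :: "'a::real_normed_vector \<Rightarrow> real"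
  assumes "smooth_norm TYPE('a)" "x \<noteq> 0"
    and "linear f" "\<And>h. f h \<le> norm h" "f x = norm x"
    and "linear g" "\<And>h. g h \<le> norm h" "g x = norm x"
  shows "f h = g h"
proof -
  obtain D where "\<And>h. ((\<lambda>t. (norm (x + t *\<^sub>R h) - norm x) / t) \<longlongrightarrow> D h) (at 0)"
    using assms(1,2) unfolding smooth_norm_def gateaux_differentiable_at_def by blast
  then have "f h = D h" "g h = D h"
    using supporting_functional_eq_derivative assms(3-8) by blast+
  then show ?thesis by simp
qed

locale smooth_semi_inner_product =
  fixes ip :: "'a::real_normed_vector \<Rightarrow> 'a \<Rightarrow> real"
  assumes smooth: "smooth_norm TYPE('a)" and induced: "induced_semi_inner_product ip"
begin

lemma ip_add_left: "ip (x + y) z = ip x z + ip y z"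
  and ip_scale_left: "ip (c *\<^sub>R x) z = c * ip x z"
  and ip_self: "ip x x = (norm x)\<^sup>2"
  using induced unfolding induced_semi_inner_product_def semi_inner_product_def by blast+

lemma ip_diff_left: "ip (x - y) z = ip x z - ip y z"
  using ip_add_left[of "x - y" y z] by simp

lemma abs_ip_le: "\<bar>ip x y\<bar> \<le> norm x * norm y"
proof -
  have "\<bar>ip x y\<bar>\<^sup>2 \<le> (norm x * norm y)\<^sup>2"
    using induced unfolding induced_semi_inner_product_def semi_inner_product_def
    by (metis power_mult_distrib)
  then show ?thesis by (rule power2_le_imp_le) simp
qed

text \<open>Both \<open>[\<cdot>, x] / \<parallel>x\<parallel>\<close> and the multiple of \<open>[\<cdot>, y]\<close> that takes the value \<open>\<parallel>x\<parallel>\<close> at \<open>x\<close> are bounded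
  by the norm, the latter precisely because of the assumed equality. So they are supporting
  functionals at the same point, where the smooth norm has only one.\<close>

lemma Cauchy_Schwarz_equality:
  assumes eq: "\<bar>ip x y\<bar> = norm x * norm y"
  shows "(norm x)\<^sup>2 * ip h y = ip x y * ip h x"
proof (cases "x = 0 \<or> y = 0")
  case True
  then show ?thesis using abs_ip_le[of x y] abs_ip_le[of h y] by auto
next
  case False
  then have pos: "norm x > 0" "norm y > 0" and nz: "ip x y \<noteq> 0" using eq by auto
  define f where "f = (\<lambda>h. ip h y * norm x / ip x y)"
  define g where "g = (\<lambda>h. ip h x / norm x)"
  have "linear f" "linear g" unfolding f_def g_def
    by (auto intro!: linearI simp: ip_add_left ip_scale_left add_divide_distrib distrib_right)
  moreover have "f h \<le> norm h" for h
  proof -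
    have "\<bar>f h\<bar> = \<bar>ip h y\<bar> / norm y"
      unfolding f_def using pos eq by (simp add: abs_mult field_simps)
    also have "\<dots> \<le> norm h" using abs_ip_le[of h y] pos by (simp add: field_simps)
    finally show ?thesis by simp
  qed
  moreover have "g h \<le> norm h" for h
    unfolding g_def using abs_ip_le[of h x] pos by (simp add: field_simps)
  moreover have "f x = norm x" "g x = norm x"
    unfolding f_def g_def using nz pos by (simp_all add: ip_self power2_eq_square)
  ultimately have "f h = g h"
    using supporting_functional_unique[OF smooth] False by blast
  then show ?thesis
    unfolding f_def g_def using pos nz by (simp add: field_simps power2_eq_square)
qed

text \<open>The pair \<open>y\<close>, \<open>c y\<close> attains equality in the Cauchy-Schwarz inequality.\<close>

lemma ip_scale_right: "ip h (c *\<^sub>R y) = c * ip h y"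
proof (cases "c = 0 \<or> y = 0")
  case True
  then show ?thesis using abs_ip_le[of h 0] by auto
next
  case False
  then have "c * ip y (c *\<^sub>R y) = c * (c * (norm y)\<^sup>2)"
    by (metis ip_scale_left ip_self norm_scaleR power2_abs power2_eq_square
        power_mult_distrib mult.assoc)
  then have y: "ip y (c *\<^sub>R y) = c * (norm y)\<^sup>2" using False by simp
  then have "\<bar>ip y (c *\<^sub>R y)\<bar> = norm y * norm (c *\<^sub>R y)"
    by (simp add: abs_mult power2_eq_square)
  then show ?thesis using Cauchy_Schwarz_equality[of y "c *\<^sub>R y" h] y False by simp
qed

end

section \<open>Real eigenvectors of adjoint abelian operators\<close>

text \<open>The zero vector is included; it is excluded later by linear independence.\<close>

definition eigenvectors :: "('a::real_vector \<Rightarrow> 'a) \<Rightarrow> 'a set" where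
  "eigenvectors A = {v. \<exists>c. A v = c *\<^sub>R v}"

text \<open>The finite spanning set \<open>B\<close> only witnesses that the space is finite-dimensional.\<close>

locale adjoint_abelian_operator = smooth_semi_inner_product ip
  for ip :: "'a::real_normed_vector \<Rightarrow> 'a \<Rightarrow> real" +
  fixes A :: "'a \<Rightarrow> 'a" and B :: "'a set"
  assumes adjoint: "adjoint_abelian ip A"
    and finite_B: "finite B" and span_B: "span B = UNIV"
begin

lemma linear_A: "linear A" and ip_A: "ip (A x) y = ip x (A y)"
  using adjoint unfolding adjoint_abelian_def by blast+

lemmas A_simps = linear_A[THEN linear_add] linear_A[THEN linear_diff] linear_A[THEN linear_scale]

text \<open>At a maximizer \<open>x\<close> of \<open>\<parallel>A x\<parallel> / \<parallel>x\<parallel>\<close> the functional \<open>[\<cdot>, x]\<close> annihilates the range of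
  \<open>A\<^sup>2 - r\<^sup>2\<close>, which therefore has a kernel in \<open>W\<close>. The maximizer itself need not be an
  eigenvector.\<close>

lemma real_eigenvector_exists:
  assumes W: "subspace W" "W \<noteq> {0}" "A ` W \<subseteq> W"
  obtains v c where "v \<in> W" "v \<noteq> 0" "A v = c *\<^sub>R v"
proof -
  obtain x r where x: "x \<in> W" "x \<noteq> 0" and r: "norm (A x) = r * norm x"
    and max: "\<And>y. y \<in> W \<Longrightarrow> norm (A y) \<le> r * norm y"
    using operator_norm_attained[OF finite_B span_B W(1,2) linear_A] by metis
  define T where "T = (\<lambda>h. A (A h) - r\<^sup>2 *\<^sub>R h)"
  have ip_x: "ip x (A (A x)) = r\<^sup>2 * (norm x)\<^sup>2"
    using ip_A[of x "A x"] r by (simp add: ip_self power_mult_distrib)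
  have "\<bar>ip x (A (A x))\<bar> = norm x * norm (A (A x))"
  proof (rule antisym[OF abs_ip_le])
    have "norm (A (A x)) \<le> r * (r * norm x)"
      using max[of "A x"] r x(1) W(3) by auto
    then have "norm x * norm (A (A x)) \<le> norm x * (r * (r * norm x))"
      by (rule mult_left_mono) simp
    then show "norm x * norm (A (A x)) \<le> \<bar>ip x (A (A x))\<bar>"
      using ip_x by (simp add: power2_eq_square ac_simps)
  qed
  then have "(norm x)\<^sup>2 * ip h (A (A x)) = r\<^sup>2 * (norm x)\<^sup>2 * ip h x" for h
    using Cauchy_Schwarz_equality ip_x by metis
  then have "ip h (A (A x)) = r\<^sup>2 * ip h x" for h
    using x(2) by (simp add: ac_simps)
  then have T_perp: "ip (T h) x = 0" for h
    unfolding T_def by (simp add: ip_diff_left ip_scale_left ip_A)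
  have "linear T" unfolding T_def
    by (auto intro!: linearI simp: A_simps algebra_simps)
  moreover have "T ` W \<subseteq> W"
    unfolding T_def using W by (auto intro!: subspace_diff subspace_scale)
  moreover have "T ` W \<noteq> W"
  proof
    assume "T ` W = W"
    then obtain h where "x = T h" using x(1) by blast
    then show False using T_perp[of h] ip_self[of x] x(2) by simp
  qed
  ultimately obtain y where y: "y \<in> W" "y \<noteq> 0" "T y = 0"
    using injective_endomorphism_onto[OF finite_B span_B W(1)] by blast
  show ?thesis
  proof (cases "A y = r *\<^sub>R y")
    case True
    then show ?thesis using that y by blast
  next
    case False
    \<comment> \<open>\<open>0 = (A\<^sup>2 - r\<^sup>2) y = (A + r) (A - r) y\<close>\<close>
    have "A (A y - r *\<^sub>R y) = (- r) *\<^sub>R (A y - r *\<^sub>R y)"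
      using y(3) unfolding T_def by (simp add: A_simps algebra_simps power2_eq_square)
    moreover have "A y - r *\<^sub>R y \<in> W" using y(1) W by (auto intro!: subspace_diff subspace_scale)
    ultimately show ?thesis using that[of "A y - r *\<^sub>R y" "- r"] False by simp
  qed
qed

text \<open>With \<open>S = A - c\<close> for an eigenvalue \<open>c\<close> of \<open>A\<close> on \<open>W\<close>, the induction hypothesis applies to
  \<open>S W\<close>, which is \<open>A\<close>-invariant and smaller than \<open>W\<close>. As \<open>S\<close> is injective on \<open>S W\<close>, it
  maps \<open>S W\<close> onto itself, so each \<open>w \<in> W\<close> differs from an element of \<open>S W\<close> by an element of
  \<open>ker S\<close>.\<close>

lemma invariant_subspace_subset_span_eigenvectors:
  assumes "subspace W" "A ` W \<subseteq> W"
  shows "W \<subseteq> span (eigenvectors A)"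
  using assms
proof (induction "dim W" arbitrary: W rule: less_induct)
  case less
  show ?case
  proof (cases "W = {0}")
    case True
    then show ?thesis by (simp add: span_zero)
  next
    case False
    obtain v c where v: "v \<in> W" "v \<noteq> 0" "A v = c *\<^sub>R v"
      using real_eigenvector_exists[OF less.prems(1) False less.prems(2)] by blast
    define S where "S = (\<lambda>x. A x - c *\<^sub>R x)"
    have S: "linear S" unfolding S_def
      by (auto intro!: linearI simp: A_simps algebra_simps)
    have SW: "S ` W \<subseteq> W"
      unfolding S_def using less.prems by (auto intro!: subspace_diff subspace_scale)
    have sub: "subspace (S ` W)" using linear_subspace_image[OF S less.prems(1)] .
    have ker: "y = 0" if "y \<in> S ` W" "S y = 0" for y
    proof -
      obtain w where w: "y = S w" using \<open>y \<in> S ` W\<close> by blast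
      have "ip (S w) y = ip w (A y) - c * ip w y"
        unfolding S_def by (simp add: ip_diff_left ip_scale_left ip_A)
      also have "\<dots> = 0"
        using \<open>S y = 0\<close> by (simp add: S_def ip_scale_right)
      finally show ?thesis using w ip_self[of y] by simp
    qed
    have onto: "S ` S ` W = S ` W"
      using SW ker by (intro injective_endomorphism_onto[OF finite_B span_B sub S]) auto
    have "S ` W \<noteq> W" using ker v unfolding S_def by auto
    then have "dim (S ` W) < dim W"
      using SW by (intro dim_strict_mono_subspace[OF finite_B span_B sub less.prems(1)]) auto
    moreover have "A ` S ` W \<subseteq> S ` W"
    proof -
      have "A (S w) = S (A w)" for w unfolding S_def by (simp add: A_simps)
      then show ?thesis using less.prems(2) by auto
    qed
    ultimately have IH: "S ` W \<subseteq> span (eigenvectors A)" using less.hyps sub by blast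
    show ?thesis
    proof
      fix w assume "w \<in> W"
      then have "S w \<in> S ` S ` W" using onto by blast
      then obtain n where n: "n \<in> S ` W" "S w = S n" by blast
      then have "A (w - n) = c *\<^sub>R (w - n)"
        unfolding S_def by (simp add: A_simps algebra_simps)
      then have "w - n \<in> span (eigenvectors A)"
        by (intro span_base) (auto simp: eigenvectors_def)
      then have "(w - n) + n \<in> span (eigenvectors A)" using IH n(1) by (blast intro: span_add)
      then show "w \<in> span (eigenvectors A)" by simp
    qed
  qed
qed

lemma eigenvector_basis:
  obtains E where "E \<subseteq> eigenvectors A" "independent E" "span E = UNIV" "finite E"
proof -
  obtain E where E: "E \<subseteq> eigenvectors A" "independent E" "eigenvectors A \<subseteq> span E"
    using maximal_independent_subset by blast
  have "span (eigenvectors A) = UNIV"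
    using invariant_subspace_subset_span_eigenvectors[of UNIV] by auto
  then have "span E = UNIV" using span_minimal[OF E(3)] by auto
  moreover have "finite E" using independent_span_bound[OF finite_B E(2)] span_B by simp
  ultimately show ?thesis using that E by blast
qed

end

section \<open>The decomposition\<close>

lemma basis_direct_sum_decomposition:
  fixes E :: "'a::real_vector set"
  assumes E: "independent E" "span E = UNIV" "finite E" and b: "bij_betw b {..<n} E"
  shows "direct_sum_decomposition n (\<lambda>i. span {b i})"
  unfolding direct_sum_decomposition_def
proof (intro conjI allI impI ex_ex1I; (elim conjE)?)
  fix v :: 'a
  obtain u where "v = (\<Sum>e\<in>E. u e *\<^sub>R e)" using E span_finite[OF E(3)] by auto
  also have "\<dots> = (\<Sum>i<n. u (b i) *\<^sub>R b i)"
    using sum.reindex_bij_betw[OF b, of "\<lambda>e. u e *\<^sub>R e"] by simp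
  finally have "v = (\<Sum>i<n. (\<lambda>i\<in>{..<n}. u (b i) *\<^sub>R b i) i)" by simp
  moreover have "(\<lambda>i\<in>{..<n}. u (b i) *\<^sub>R b i) \<in> (\<Pi>\<^sub>E i\<in>{..<n}. span {b i})"
    by (auto simp: span_base span_scale)
  ultimately show "\<exists>w. w \<in> (\<Pi>\<^sub>E i\<in>{..<n}. span {b i}) \<and> v = (\<Sum>i<n. w i)" by blast
next
  fix v w w'
  assume w: "w \<in> (\<Pi>\<^sub>E i\<in>{..<n}. span {b i})" and w': "w' \<in> (\<Pi>\<^sub>E i\<in>{..<n}. span {b i})"
    and v: "v = (\<Sum>i<n. w i)" "v = (\<Sum>i<n. w' i)"
  have "\<exists>c. w i - w' i = c *\<^sub>R b i" if "i < n" for i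
  proof -
    have "w i - w' i \<in> span {b i}" using w w' that by (intro span_diff) auto
    then show ?thesis by (auto simp: span_singleton)
  qed
  then obtain c where c: "\<And>i. i < n \<Longrightarrow> w i - w' i = c i *\<^sub>R b i" by metis
  define u where "u = (\<lambda>e. c (the_inv_into {..<n} b e))"
  have u: "u (b i) = c i" if "i < n" for i
    using the_inv_into_f_f[of b "{..<n}" i] b that by (simp add: u_def bij_betw_def)
  have "(\<Sum>e\<in>E. u e *\<^sub>R e) = (\<Sum>i<n. u (b i) *\<^sub>R b i)"
    using sum.reindex_bij_betw[OF b, of "\<lambda>e. u e *\<^sub>R e"] by simp
  also have "\<dots> = (\<Sum>i<n. w i - w' i)" using u c by simp
  also have "\<dots> = 0" using v by (simp add: sum_subtractf)
  finally have "u e = 0" if "e \<in> E" for e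
    using independentD[OF E(1,3) subset_refl] that by blast
  then have "w i = w' i" if "i < n" for i
    using that c[of i] u[of i] bij_betwE[OF b] by (metis eq_iff_diff_eq_0 lessThan_iff scaleR_zero_left)
  then show "w = w'" using PiE_ext[OF w w'] by simp
qed simp

theorem theorem5:
  fixes ip :: "'a::banach \<Rightarrow> 'a \<Rightarrow> real" and A :: "'a \<Rightarrow> 'a"
  assumes "\<exists>B::'a set. finite B \<and> span B = UNIV"
    and "smooth_norm TYPE('a)"
    and "induced_semi_inner_product ip"
    and "adjoint_abelian ip A"
  shows "\<exists>n W. direct_sum_decomposition n W \<and>
    (\<forall>i<n. invariant_subspace A (W i) \<and> dim (W i) \<le> 2 \<and>
       (dim (W i) = 2 \<longrightarrow> generalized_dilatation_on ip A (W i)))"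
proof -
  obtain B :: "'a set" where "finite B" "span B = UNIV" using assms(1) by blast
  then interpret adjoint_abelian_operator ip A B
    using assms(2-4) by unfold_locales
  obtain E where E: "E \<subseteq> eigenvectors A" "independent E" "span E = UNIV" "finite E"
    by (rule eigenvector_basis)
  obtain b where b: "bij_betw b {..<card E} E"
    using ex_bij_betw_nat_finite[OF E(4)] by (auto simp: atLeast0LessThan)
  have "invariant_subspace A (span {b i})" if "i < card E" for i
  proof -
    have "b i \<in> eigenvectors A" using bij_betwE[OF b] that E(1) by blast
    then obtain c where "A (b i) = c *\<^sub>R b i" by (auto simp: eigenvectors_def)
    then have "A ` span {b i} \<subseteq> span {b i}" by (auto simp: span_singleton A_simps)
    then show ?thesis by (simp add: invariant_subspace_def subspace_span)
  qed
  moreover have "dim (span {b i}) \<le> 2" "dim (span {b i}) \<noteq> 2" for i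
    using dim_le_card[of "span {b i}" "{b i}"] by simp_all
  ultimately show ?thesis
    using basis_direct_sum_decomposition[OF E(2-4) b] by blast
qed

end
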